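(* Let $n\ge2$ and let $G$ be a finite simple graph with vertex set $\{1,\dots,r\}$. For every $\sigma\in S_r$, relabeling induces a canonical graded algebra isomorphism $A_G^{(n)}\to A_{\sigma G}^{(n)}$ carrying $a_{ij}^G$ to $a_{\sigma(i)\sigma(j)}^{\sigma G}$ and $b_{ij}^G$ to $b_{\sigma(i)\sigma(j)}^{\sigma G}$ for every edge $ij$ of $G$. These isomorphisms are compatible with composition in $S_r$. Consequently, $G\mapsto[A_G^{(n)}]$ (the isomorphism class as a graded $\mathbb Q$-algebra) is a graph invariant.
   Context: $\sigma G$ is the graph on $\{1,\dots,r\}$ with edges $\sigma(i)\sigma(j)$ for $ij\in E(G)$. Let $\mathrm{Conf}_G(\mathbb P^{n-1}(\mathbb C))=\{(\ell_v)_{v\in V(G)}\in \mathbb P^{n-1}(\mathbb C)^{V(G)}: \ell_u\ne\ell_v \text{ whenever } uv\in E(G)\}$. For an edge $e=uv$ let $\phi_e^G:\mathrm{Conf}_G(\mathbb P^{n-1}(\mathbb C))\to\mathrm{Gr}(2,n)$ be the span map $(\ell_w)\mapsto\langle\ell_u,\ell_v\rangle$, let $\mathcal S$ be the tautological rank-two subbundle on $\mathrm{Gr}(2,n)$, and put $a_e^G=(\phi_e^G)^*c_1(\mathcal S^* )$ (degree 2), $b_e^G=(\phi_e^G)^*c_2(\mathcal S^* )$ (degree 4). The edge-span algebra $A_G^{(n)}$ is the unital graded $\mathbb Q$-subalgebra of $H^*(\mathrm{Conf}_G(\mathbb P^{n-1}(\mathbb C));\mathbb Q)$ generated by all $a_e^G,b_e^G$,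 $e\in E(G)$. *)

theory Defs
  imports
    "HOL-Analysis.Analysis"
    "HOL-Homology.Homology"
    "HOL-Algebra.QuotRing"
    "HOL-Algebra.Module"
    "HOL-Library.Function_Algebras"
    "HOL-Combinatorics.Permutations"
begin

section \<open>Graded algebras over the rationals\<close>

record 'a graded_algebra = "(rat, 'a) module" +
  grade :: "nat \<Rightarrow> 'a set"

inductive_set generated_subalgebra :: "('a, 'm) graded_algebra_scheme \<Rightarrow> 'a set \<Rightarrow> 'a set"
  for R S where
  one: "\<one>\<^bsub>R\<^esub> \<in> generated_subalgebra R S"
| incl: "x \<in> S \<Longrightarrow> x \<in> generated_subalgebra R S"
| add: "x \<in> generated_subalgebra R S \<Longrightarrow> y \<in> generated_subalgebra R S \<Longrightarrow>
    x \<oplus>\<^bsub>R\<^esub> y \<in> generated_subalgebra R S"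
| mult: "x \<in> generated_subalgebra R S \<Longrightarrow> y \<in> generated_subalgebra R S \<Longrightarrow>
    x \<otimes>\<^bsub>R\<^esub> y \<in> generated_subalgebra R S"
| smult: "x \<in> generated_subalgebra R S \<Longrightarrow> q \<odot>\<^bsub>R\<^esub> x \<in> generated_subalgebra R S"

text \<open>For homogeneous \<open>S\<close> the generated subalgebra is automatically a graded subalgebra, with the
  grading induced from \<open>R\<close>.\<close>

definition subalgebra_generated_by :: "'a graded_algebra \<Rightarrow> 'a set \<Rightarrow> 'a graded_algebra" where
  "subalgebra_generated_by R S =
     R\<lparr>carrier := generated_subalgebra R S,
       grade := (\<lambda>p. generated_subalgebra R S \<inter> grade R p)\<rparr>"

definition graded_alg_iso :: "'a graded_algebra \<Rightarrow> 'b graded_algebra \<Rightarrow> ('a \<Rightarrow> 'b) set" where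
  "graded_alg_iso A B =
     {h \<in> ring_iso A B.
        (\<forall>q. \<forall>x \<in> carrier A. h (q \<odot>\<^bsub>A\<^esub> x) = q \<odot>\<^bsub>B\<^esub> h x) \<and>
        (\<forall>p. h ` grade A p = grade B p)}"

definition iso_class :: "'a graded_algebra \<Rightarrow> 'a graded_algebra set" where
  "iso_class A = {B. graded_alg_iso A B \<noteq> {}}"


section \<open>Singular cohomology with rational coefficients\<close>

text \<open>An element of the total cochain group \<open>\<Oplus>\<^sub>p C\<^sup>p(X; \<rat>)\<close> is a function \<open>\<phi>\<close> with
  \<open>\<phi> p s\<close> the value of its degree \<open>p\<close> component on the singular \<open>p\<close>-simplex \<open>s\<close>; it is \<open>0\<close> on
  everything that is not a singular simplex of \<open>X\<close>.\<close>

type_synonym 'a cochain = "nat \<Rightarrow> ((nat \<Rightarrow> real) \<Rightarrow> 'a) \<Rightarrow> rat"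

definition cochains :: "'a topology \<Rightarrow> 'a cochain set" where
  "cochains X = {\<phi>. finite {p. \<phi> p \<noteq> 0} \<and> (\<forall>p s. \<not> singular_simplex p X s \<longrightarrow> \<phi> p s = 0)}"

definition coboundary :: "'a topology \<Rightarrow> 'a cochain \<Rightarrow> 'a cochain" where
  "coboundary X \<phi> = (\<lambda>p s.
     if 0 < p \<and> singular_simplex p X s
     then \<Sum>k\<le>p. (-1) ^ k * \<phi> (p - 1) (singular_face p k s) else 0)"

definition front_face :: "nat \<Rightarrow> ((nat \<Rightarrow> real) \<Rightarrow> 'a) \<Rightarrow> (nat \<Rightarrow> real) \<Rightarrow> 'a" where
  "front_face p s = restrict s (standard_simplex p)"

text \<open>The last \<open>q\<close>-dimensional face of a \<open>(p + q)\<close>-simplex.\<close>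

definition back_face :: "nat \<Rightarrow> nat \<Rightarrow> ((nat \<Rightarrow> real) \<Rightarrow> 'a) \<Rightarrow> (nat \<Rightarrow> real) \<Rightarrow> 'a" where
  "back_face p q s = restrict (\<lambda>t. s (\<lambda>i. if i < p then 0 else t (i - p))) (standard_simplex q)"

definition cup :: "'a topology \<Rightarrow> 'a cochain \<Rightarrow> 'a cochain \<Rightarrow> 'a cochain" where
  "cup X \<phi> \<psi> = (\<lambda>m s.
     if singular_simplex m X s
     then \<Sum>p\<le>m. \<phi> p (front_face p s) * \<psi> (m - p) (back_face p (m - p) s) else 0)"

definition cocycle_ring :: "'a topology \<Rightarrow> 'a cochain ring" where
  "cocycle_ring X =
     \<lparr>carrier = {\<phi> \<in> cochains X. coboundary X \<phi> = 0},
      mult = cup X,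
      one = (\<lambda>p s. if p = 0 \<and> singular_simplex p X s then 1 else 0),
      zero = 0,
      add = (+)\<rparr>"

definition coboundaries :: "'a topology \<Rightarrow> 'a cochain set" where
  "coboundaries X = coboundary X ` cochains X"

definition cohom_class :: "'a topology \<Rightarrow> 'a cochain \<Rightarrow> 'a cochain set" where
  "cohom_class X \<phi> = coboundaries X +>\<^bsub>cocycle_ring X\<^esub> \<phi>"

definition cohomology :: "'a topology \<Rightarrow> 'a cochain set graded_algebra" where
  "cohomology X = (let Q = cocycle_ring X Quot coboundaries X in
     \<lparr>carrier = carrier Q, mult = mult Q, one = one Q, zero = zero Q, add = add Q,
      smult = (\<lambda>q c. \<Union>\<phi>\<in>c. cohom_class X (\<lambda>p s. q * \<phi> p s)),
      grade = (\<lambda>p. {cohom_class X \<phi> | \<phi>. \<phi> \<in> carrier (cocycle_ring X) \<and> (\<forall>q. q \<noteq> p \<longrightarrow> \<phi> q = 0)})\<rparr>)"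

definition cochain_pullback :: "'a topology \<Rightarrow> ('a \<Rightarrow> 'b) \<Rightarrow> 'b cochain \<Rightarrow> 'a cochain" where
  "cochain_pullback X f \<phi> = (\<lambda>p s. if singular_simplex p X s then \<phi> p (simplex_map p f s) else 0)"

text \<open>The map \<open>f\<^sup>*\<close> on cohomology classes, for \<open>f\<close> defined on \<open>X\<close>. If \<open>f\<close> is continuous, all the
  cosets in the union coincide.\<close>

definition pullback :: "'a topology \<Rightarrow> ('a \<Rightarrow> 'b) \<Rightarrow> 'b cochain set \<Rightarrow> 'a cochain set" where
  "pullback X f c = (\<Union>\<phi>\<in>c. cohom_class X (cochain_pullback X f \<phi>))"


section \<open>Quotient topologies, Grassmannians and projective spaces\<close>

definition quotient_topology :: "'a topology \<Rightarrow> ('a \<Rightarrow> 'b) \<Rightarrow> 'b topology" where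
  "quotient_topology X f =
     topology (\<lambda>U. U \<subseteq> f ` topspace X \<and> openin X {x \<in> topspace X. f x \<in> U})"

lemma openin_quotient_topology:
  "openin (quotient_topology X f) U \<longleftrightarrow>
     U \<subseteq> f ` topspace X \<and> openin X {x \<in> topspace X. f x \<in> U}"
proof -
  have "istopology (\<lambda>U. U \<subseteq> f ` topspace X \<and> openin X {x \<in> topspace X. f x \<in> U})"
    unfolding istopology_def
  proof (intro conjI allI impI)
    fix S T
    assume "S \<subseteq> f ` topspace X \<and> openin X {x \<in> topspace X. f x \<in> S}"
      and "T \<subseteq> f ` topspace X \<and> openin X {x \<in> topspace X. f x \<in> T}"
    moreover have "{x \<in> topspace X. f x \<in> S \<inter> T} =
        {x \<in> topspace X. f x \<in> S} \<inter> {x \<in> topspace X. f x \<in> T}" by blast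
    ultimately show "S \<inter> T \<subseteq> f ` topspace X" "openin X {x \<in> topspace X. f x \<in> S \<inter> T}"
      by auto
  next
    fix \<K>
    assume "\<forall>K\<in>\<K>. K \<subseteq> f ` topspace X \<and> openin X {x \<in> topspace X. f x \<in> K}"
    moreover have "{x \<in> topspace X. f x \<in> \<Union>\<K>} = (\<Union>K\<in>\<K>. {x \<in> topspace X. f x \<in> K})"
      by blast
    ultimately show "\<Union>\<K> \<subseteq> f ` topspace X" "openin X {x \<in> topspace X. f x \<in> \<Union>\<K>}"
      by auto
  qed
  then show ?thesis
    unfolding quotient_topology_def by simp
qed

text \<open>\<open>Gr(k, n)\<close> for \<open>n = CARD('n)\<close>, as the set of \<open>k\<close>-dimensional subspaces of \<open>\<complex>\<^sup>n\<close> with the quotient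
  topology from the space of linearly independent \<open>k\<close>-tuples.\<close>

definition frames :: "nat \<Rightarrow> (nat \<Rightarrow> complex^'n::finite) topology" where
  "frames k = subtopology (product_topology (\<lambda>_. euclidean) {..<k})
     {b. inj_on b {..<k} \<and> vec.independent (b ` {..<k})}"

definition grassmannian :: "nat \<Rightarrow> (complex^'n::finite) set topology" where
  "grassmannian k = quotient_topology (frames k) (\<lambda>b. vec.span (b ` {..<k}))"

abbreviation projective_space :: "(complex^'n::finite) set topology" where
  "projective_space \<equiv> grassmannian 1"


section \<open>Complex vector bundles and Chern classes\<close>

text \<open>All fibres are subspaces of one ambient complex vector space with scalar multiplication
  \<open>fscale\<close>. The total space has underlying set \<open>{(x, v). x \<in> topspace base_space \<and> v \<in> fibre x}\<close>.\<close>

record ('b, 'v) vbundle =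
  base_space :: "'b topology"
  fibre :: "'b \<Rightarrow> 'v set"
  fscale :: "complex \<Rightarrow> 'v \<Rightarrow> 'v"
  total_space :: "('b \<times> 'v) topology"

definition tautological_subbundle ::
  "nat \<Rightarrow> ((complex^'n::finite) set, complex^'n) vbundle" where
  "tautological_subbundle k =
     \<lparr>base_space = grassmannian k, fibre = (\<lambda>W. W), fscale = (*s),
      total_space = subtopology (prod_topology (grassmannian k) euclidean) {(W, v). v \<in> W}\<rparr>"

definition dual_fibre :: "('b, 'v::ab_group_add) vbundle \<Rightarrow> 'b \<Rightarrow> ('v \<Rightarrow> complex) set" where
  "dual_fibre E x =
     {f. (\<forall>v\<in>fibre E x. \<forall>w\<in>fibre E x. f (v + w) = f v + f w) \<and>
         (\<forall>a. \<forall>v\<in>fibre E x. f (fscale E a v) = a * f v) \<and>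
         (\<forall>v. v \<notin> fibre E x \<longrightarrow> f v = 0)}"

definition local_section :: "('b, 'v) vbundle \<Rightarrow> 'b set \<Rightarrow> ('b \<Rightarrow> 'v) \<Rightarrow> bool" where
  "local_section E U s \<longleftrightarrow> openin (base_space E) U \<and> (\<forall>x\<in>U. s x \<in> fibre E x) \<and>
     continuous_map (subtopology (base_space E) U) (total_space E) (\<lambda>x. (x, s x))"

text \<open>The dual bundle: linear functionals on the fibres of \<open>E\<close> (extended by \<open>0\<close>). The topology is
  the coarsest one for which the projection and the evaluations at continuous local sections of \<open>E\<close>
  are continuous. A local frame of \<open>E\<close> over \<open>U\<close> identifies its restriction to \<open>U\<close>
  with \<open>U \<times> \<complex>\<^sup>k\<close>.\<close>

definition dual_bundle :: "('b, 'v::ab_group_add) vbundle \<Rightarrow> ('b, 'v \<Rightarrow> complex) vbundle" where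
  "dual_bundle E =
     \<lparr>base_space = base_space E, fibre = dual_fibre E, fscale = (\<lambda>a f v. a * f v),
      total_space = topology_generated_by
        {{(x, f). x \<in> U \<and> f \<in> dual_fibre E x \<and> f (s x) \<in> T} | U s T. local_section E U s \<and> open T}\<rparr>"

definition nonzero_part :: "('b, 'v::zero) vbundle \<Rightarrow> ('b \<times> 'v) topology" where
  "nonzero_part E = subtopology (total_space E) {(x, v). v \<noteq> 0}"

text \<open>The bundle \<open>P(E)\<close> of lines in the fibres of \<open>E\<close>, and its tautological line bundle
  \<open>O(-1) \<subseteq> \<pi>\<^sup>*E\<close>.\<close>

definition projectivisation :: "('b, 'v::zero) vbundle \<Rightarrow> ('b \<times> 'v set) topology" where
  "projectivisation E = quotient_topology (nonzero_part E) (\<lambda>(x, v). (x, range (\<lambda>a. fscale E a v)))"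

definition tautological_line :: "('b, 'v::zero) vbundle \<Rightarrow> ('b \<times> 'v set, 'v) vbundle" where
  "tautological_line E =
     \<lparr>base_space = projectivisation E, fibre = snd, fscale = fscale E,
      total_space = pullback_topology {((x, l), v). (x, l) \<in> topspace (projectivisation E) \<and> v \<in> l}
        (\<lambda>((x, l), v). ((x, l), (x, v))) (prod_topology (projectivisation E) (total_space E))\<rparr>"

text \<open>For \<open>v \<noteq> 0\<close> in the fibre \<open>L\<^sub>x\<close> of a line bundle, the affine 2-simplex in \<open>L\<^sub>x\<close> with vertices
  \<open>v\<close>, \<open>\<omega>v\<close>, \<open>\<omega>\<^sup>2v\<close> (\<open>\<omega> = exp(2\<pi>i/3)\<close>) contains \<open>0\<close> in its interior and represents the generator of
  \<open>H\<^sub>2(L\<^sub>x, L\<^sub>x - 0)\<close> given by the complex orientation.\<close>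

definition fibre_simplex :: "('b, 'v) vbundle \<Rightarrow> 'b \<Rightarrow> 'v \<Rightarrow> (nat \<Rightarrow> real) \<Rightarrow> 'b \<times> 'v" where
  "fibre_simplex L x v = restrict
     (\<lambda>t. (x, fscale L (\<Sum>j\<le>2. of_real (t j) * cis (2 * pi * real j / 3)) v)) (standard_simplex 2)"

text \<open>A relative cocycle of \<open>(L, L - 0)\<close> representing the Thom class of the line bundle \<open>L\<close>.\<close>

definition thom_cocycle :: "('b, 'v::zero) vbundle \<Rightarrow> ('b \<times> 'v) cochain \<Rightarrow> bool" where
  "thom_cocycle L \<phi> \<longleftrightarrow>
     \<phi> \<in> carrier (cocycle_ring (total_space L)) \<and> (\<forall>p. p \<noteq> 2 \<longrightarrow> \<phi> p = 0) \<and>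
     (\<forall>s. singular_simplex 2 (nonzero_part L) s \<longrightarrow> \<phi> 2 s = 0) \<and>
     (\<forall>x \<in> topspace (base_space L). \<forall>v \<in> fibre L x. v \<noteq> 0 \<longrightarrow> \<phi> 2 (fibre_simplex L x v) = 1)"

text \<open>\<open>c\<^sub>1\<close> of a line bundle is its Euler class, the restriction of the Thom class to the
  zero section. It exists uniquely by the Thom isomorphism, so for line bundles the \<open>else\<close>
  branch, which keeps the function total, is never taken.\<close>

definition is_euler_class :: "('b, 'v::zero) vbundle \<Rightarrow> 'b cochain set \<Rightarrow> bool" where
  "is_euler_class L c \<longleftrightarrow> (\<exists>\<phi>. thom_cocycle L \<phi> \<and>
     c = cohom_class (base_space L) (cochain_pullback (base_space L) (\<lambda>x. (x, 0)) \<phi>))"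

definition c1_line :: "('b, 'v::zero) vbundle \<Rightarrow> 'b cochain set" where
  "c1_line L = (if \<exists>!c. is_euler_class L c then THE c. is_euler_class L c
     else \<zero>\<^bsub>cohomology (base_space L)\<^esub>)"

text \<open>Chern classes of a rank \<open>k\<close> bundle \<open>E\<close>, following Grothendieck: \<open>c\<^sub>0 = 1\<close> and
  \<open>\<Sum>\<^sub>i \<pi>\<^sup>*c\<^sub>i(E) x\<^sup>k\<^sup>-\<^sup>i = 0\<close> in \<open>H\<^sup>*(P(E))\<close>, where \<open>\<pi>: P(E) \<rightarrow> B\<close> is the projection from the bundle of
  lines in \<open>E\<close> and \<open>x = c\<^sub>1(O(1))\<close> for \<open>O(1)\<close> the dual of the tautological line bundle.\<close>

definition is_chern_system ::
  "nat \<Rightarrow> ('b, 'v::ab_group_add) vbundle \<Rightarrow> (nat \<Rightarrow> 'b cochain set) \<Rightarrow> bool" where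
  "is_chern_system k E c \<longleftrightarrow>
     (let B = cohomology (base_space E); P = cohomology (projectivisation E);
          x = c1_line (dual_bundle (tautological_line E))
      in c 0 = \<one>\<^bsub>B\<^esub> \<and> (\<forall>i\<le>k. c i \<in> grade B (2 * i)) \<and> (\<forall>i>k. c i = \<zero>\<^bsub>B\<^esub>) \<and>
         (\<Oplus>\<^bsub>P\<^esub>i\<in>{..k}. pullback (projectivisation E) fst (c i) \<otimes>\<^bsub>P\<^esub> (x [^]\<^bsub>P\<^esub> (k - i))) = \<zero>\<^bsub>P\<^esub>)"

text \<open>For a vector bundle of rank \<open>k\<close> there is exactly one such system (Leray-Hirsch), so again the
  \<open>else\<close> branch only serves to make the function total.\<close>

definition chern_class :: "nat \<Rightarrow> ('b, 'v::ab_group_add) vbundle \<Rightarrow> nat \<Rightarrow> 'b cochain set" where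
  "chern_class k E i =
     (if \<exists>!c. is_chern_system k E c then (THE c. is_chern_system k E c) i
      else \<zero>\<^bsub>cohomology (base_space E)\<^esub>)"


section \<open>Graph configuration spaces and edge-span algebras\<close>

record 'v graph =
  vertices :: "'v set"
  edges :: "'v set set"

definition simple_graph :: "'v graph \<Rightarrow> bool" where
  "simple_graph G \<longleftrightarrow> finite (vertices G) \<and>
     (\<forall>e\<in>edges G. \<exists>u\<in>vertices G. \<exists>v\<in>vertices G. u \<noteq> v \<and> e = {u, v})"

definition relabel :: "('v \<Rightarrow> 'v) \<Rightarrow> 'v graph \<Rightarrow> 'v graph" where
  "relabel \<sigma> G = \<lparr>vertices = \<sigma> ` vertices G, edges = (`) \<sigma> ` edges G\<rparr>"

definition graph_isomorphic :: "'v graph \<Rightarrow> 'w graph \<Rightarrow> bool" where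
  "graph_isomorphic G H \<longleftrightarrow> (\<exists>f. bij_betw f (vertices G) (vertices H) \<and>
     (\<forall>u\<in>vertices G. \<forall>v\<in>vertices G. {u, v} \<in> edges G \<longleftrightarrow> {f u, f v} \<in> edges H))"

text \<open>The dimension \<open>n\<close> is passed as the index type \<open>'n\<close> with \<open>n = CARD('n)\<close>.\<close>

definition conf :: "'n::finite itself \<Rightarrow> 'v graph \<Rightarrow> ('v \<Rightarrow> (complex^'n) set) topology" where
  "conf _ G = subtopology (product_topology (\<lambda>_. projective_space) (vertices G))
     {l. \<forall>u v. {u, v} \<in> edges G \<longrightarrow> l u \<noteq> l v}"

definition span_map :: "'v set \<Rightarrow> ('v \<Rightarrow> (complex^'n::finite) set) \<Rightarrow> (complex^'n) set" where
  "span_map e l = vec.span (\<Union>v\<in>e. l v)"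

definition chern_dual_taut :: "nat \<Rightarrow> (complex^'n::finite) set cochain set" where
  "chern_dual_taut i = chern_class 2 (dual_bundle (tautological_subbundle 2)) i"

definition edge_a ::
  "'n::finite itself \<Rightarrow> 'v graph \<Rightarrow> 'v set \<Rightarrow> ('v \<Rightarrow> (complex^'n) set) cochain set" where
  "edge_a T G e = pullback (conf T G) (span_map e) (chern_dual_taut 1)"

definition edge_b ::
  "'n::finite itself \<Rightarrow> 'v graph \<Rightarrow> 'v set \<Rightarrow> ('v \<Rightarrow> (complex^'n) set) cochain set" where
  "edge_b T G e = pullback (conf T G) (span_map e) (chern_dual_taut 2)"

definition edge_span_algebra ::
  "'n::finite itself \<Rightarrow> 'v graph \<Rightarrow> ('v \<Rightarrow> (complex^'n) set) cochain set graded_algebra" where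
  "edge_span_algebra T G = subalgebra_generated_by (cohomology (conf T G))
     (edge_a T G ` edges G \<union> edge_b T G ` edges G)"

text \<open>A permutation \<open>\<sigma>\<close> induces the map \<open>(l\<^sub>w) \<mapsto> (l\<^sub>\<sigma>\<^sub>(\<^sub>v\<^sub>))\<close> from the configuration space of
  \<open>relabel \<sigma> G\<close> to that of \<open>G\<close>, hence in cohomology a map in the opposite direction.\<close>

definition relabel_conf ::
  "('v \<Rightarrow> 'v) \<Rightarrow> 'v graph \<Rightarrow> ('v \<Rightarrow> (complex^'n::finite) set) \<Rightarrow> 'v \<Rightarrow> (complex^'n) set" where
  "relabel_conf \<sigma> G l = (\<lambda>v\<in>vertices G. l (\<sigma> v))"

definition relabel_map ::
  "'n::finite itself \<Rightarrow> ('v \<Rightarrow> 'v) \<Rightarrow> 'v graph \<Rightarrow>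
    ('v \<Rightarrow> (complex^'n) set) cochain set \<Rightarrow> ('v \<Rightarrow> (complex^'n) set) cochain set" where
  "relabel_map T \<sigma> G = pullback (conf T (relabel \<sigma> G)) (relabel_conf \<sigma> G)"

end

theory Submission
  imports Defs
begin

text \<open>
  A permutation \<open>\<sigma>\<close> of the vertices permutes the coordinates of configurations and so gives a
  homeomorphism from the configuration space of \<open>\<sigma>G\<close> to that of \<open>G\<close>, with inverse coming from
  \<open>\<sigma>\<^sup>-\<^sup>1\<close>. The span of the lines at the two ends of an edge \<open>e\<close> of \<open>G\<close>, taken after this
  homeomorphism, is the span along the edge \<open>\<sigma>(e)\<close>. The generators \<open>a\<^sub>e\<close>
  and \<open>b\<^sub>e\<close> are pullbacks of the same two classes on the Grassmannian for every edge, so by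
  functoriality they go to those of \<open>\<sigma>(e)\<close> (\<open>relabel_map_edge_classes\<close>). Functoriality also gives
  compatibility with composition (\<open>relabel_map_compose\<close>). Finally, an isomorphism between graphs on the same vertex set is a
  relabelling (\<open>graph_isomorphic_imp_relabel\<close>).

  It remains to see that a homeomorphism induces graded isomorphisms between subalgebras with
  corresponding generators (\<open>homeomorphism_pullback_subalgebra_iso\<close>). This is transport of
  structure, carried out on cochains. Pullback along a homeomorphism is a bijection between the
  functions supported on singular simplices, and it commutes with sums, scalar multiples, cup products and coboundaries. A cohomology class is a
  set of cochains, and the operations on classes are set-theoretic expressions in the operations on
  cochains. So pullback of classes is the image map of a bijection, and it preserves everything
  built from these operations.

  The image description holds for every union of cosets of the coboundaries, and such unions are
  closed under the operations. The argument is run for them, under the name of saturated sets,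
  because a pullback, in particular one along a span map, is by construction a union of cosets.
\<close>


section \<open>Unions of cosets of the coboundaries\<close>

text \<open>Support on the singular simplices is what makes a cochain recoverable from its pullback along a
  homeomorphism.\<close>

definition supported_cochains :: "'a topology \<Rightarrow> 'a cochain set" where
  "supported_cochains X = {\<phi>. \<forall>p s. \<not> singular_simplex p X s \<longrightarrow> \<phi> p s = 0}"

text \<open>The unions of cosets of the coboundaries. On these, and not on arbitrary sets of cochains,
  pullback along a homeomorphism is an image.\<close>

definition saturated :: "'a topology \<Rightarrow> 'a cochain set set" where
  "saturated X = {c. c \<subseteq> supported_cochains X \<and>
     (\<forall>\<beta>\<in>coboundaries X. \<forall>\<phi>\<in>c. \<beta> + \<phi> \<in> c)}"

lemma saturatedD:
  assumes "c \<in> saturated X"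
  shows "c \<subseteq> supported_cochains X" "\<beta> \<in> coboundaries X \<Longrightarrow> \<phi> \<in> c \<Longrightarrow> \<beta> + \<phi> \<in> c"
  using assms by (auto simp: saturated_def)

lemma saturated_Union: "(\<And>i. i \<in> I \<Longrightarrow> c i \<in> saturated X) \<Longrightarrow> (\<Union>i\<in>I. c i) \<in> saturated X"
  unfolding saturated_def by blast

lemma cohom_class_eq: "cohom_class X \<phi> = (\<lambda>\<beta>. \<beta> + \<phi>) ` coboundaries X"
  by (auto simp: cohom_class_def a_r_coset_def' cocycle_ring_def)

lemma one_cohomology:
  "\<one>\<^bsub>cohomology X\<^esub> = cohom_class X (\<lambda>p s. if p = 0 \<and> singular_simplex p X s then 1 else 0)"
  by (simp add: cohomology_def FactRing_def cohom_class_def cocycle_ring_def Let_def)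

lemma mult_cohomology:
  "a \<otimes>\<^bsub>cohomology X\<^esub> b = (\<Union>\<phi>\<in>a. \<Union>\<psi>\<in>b. cohom_class X (cup X \<phi> \<psi>))"
  by (simp add: cohomology_def FactRing_def cohom_class_def cocycle_ring_def Let_def
      rcoset_mult_def)

lemma add_cohomology:
  "a \<oplus>\<^bsub>cohomology X\<^esub> b = (\<Union>\<phi>\<in>a. \<Union>\<psi>\<in>b. {\<phi> + \<psi>})"
  by (simp add: cohomology_def FactRing_def cocycle_ring_def Let_def set_add_def')

lemma smult_cohomology:
  "q \<odot>\<^bsub>cohomology X\<^esub> c = (\<Union>\<phi>\<in>c. cohom_class X (\<lambda>p s. q * \<phi> p s))"
  by (simp add: cohomology_def Let_def)

lemma grade_cohomology:
  "grade (cohomology X) p =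
     cohom_class X ` {\<phi> \<in> cochains X. coboundary X \<phi> = 0 \<and> (\<forall>q. q \<noteq> p \<longrightarrow> \<phi> q = 0)}"
  by (auto simp: cohomology_def Let_def cocycle_ring_def)

lemmas cohomology_ops = one_cohomology mult_cohomology add_cohomology smult_cohomology

lemma supported_cochains_ops:
  "\<phi> \<in> supported_cochains X \<Longrightarrow> \<psi> \<in> supported_cochains X \<Longrightarrow> \<phi> + \<psi> \<in> supported_cochains X"
  "\<phi> \<in> supported_cochains X \<Longrightarrow> (\<lambda>p s. q * \<phi> p s) \<in> supported_cochains X"
  "cup X \<phi> \<psi> \<in> supported_cochains X"
  "(\<lambda>p s. if p = 0 \<and> singular_simplex p X s then 1 else 0) \<in> supported_cochains X"
  "coboundary X \<phi> \<in> supported_cochains X"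
  by (auto simp: supported_cochains_def cup_def coboundary_def)

lemma cochain_pullback_supported: "cochain_pullback X f \<phi> \<in> supported_cochains X"
  by (auto simp: supported_cochains_def cochain_pullback_def)

lemma coboundaries_supported: "coboundaries X \<subseteq> supported_cochains X"
  by (auto simp: coboundaries_def supported_cochains_ops)

lemma zero_in_coboundaries: "0 \<in> coboundaries X"
proof -
  have "coboundary X 0 = 0"
    by (auto simp: coboundary_def fun_eq_iff)
  moreover have "0 \<in> cochains X"
    by (auto simp: cochains_def)
  ultimately show ?thesis
    unfolding coboundaries_def by (metis imageI)
qed

lemma add_in_coboundaries:
  assumes "\<alpha> \<in> coboundaries X" "\<beta> \<in> coboundaries X"
  shows "\<alpha> + \<beta> \<in> coboundaries X"
proof -
  obtain \<phi> \<psi> where \<phi>: "\<phi> \<in> cochains X" "\<alpha> = coboundary X \<phi>"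
    and \<psi>: "\<psi> \<in> cochains X" "\<beta> = coboundary X \<psi>"
    using assms by (auto simp: coboundaries_def)
  have "\<alpha> + \<beta> = coboundary X (\<phi> + \<psi>)"
    by (auto simp: \<phi> \<psi> coboundary_def fun_eq_iff sum.distrib algebra_simps)
  moreover have "\<phi> + \<psi> \<in> cochains X"
  proof -
    have "{p. (\<phi> + \<psi>) p \<noteq> 0} \<subseteq> {p. \<phi> p \<noteq> 0} \<union> {p. \<psi> p \<noteq> 0}"
      by auto
    then have "finite {p. (\<phi> + \<psi>) p \<noteq> 0}"
      using \<phi> \<psi> by (auto simp: cochains_def intro: finite_subset)
    then show ?thesis
      using \<phi> \<psi> by (auto simp: cochains_def)
  qed
  ultimately show ?thesis
    by (auto simp: coboundaries_def)
qed

lemma mem_cohom_class: "\<phi> \<in> cohom_class X \<phi>"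
  using zero_in_coboundaries by (force simp: cohom_class_eq)

lemma cohom_class_saturated:
  assumes "\<phi> \<in> supported_cochains X"
  shows "cohom_class X \<phi> \<in> saturated X"
  unfolding saturated_def
proof (intro CollectI conjI ballI)
  show "cohom_class X \<phi> \<subseteq> supported_cochains X"
    using assms coboundaries_supported by (auto simp: cohom_class_eq intro: supported_cochains_ops)
  fix \<beta> \<psi> assume "\<beta> \<in> coboundaries X" "\<psi> \<in> cohom_class X \<phi>"
  then show "\<beta> + \<psi> \<in> cohom_class X \<phi>"
    by (auto simp: cohom_class_eq image_iff add.assoc[symmetric] intro: add_in_coboundaries)
qed

lemma saturated_eq_Union_cohom_class: "c \<in> saturated X \<Longrightarrow> (\<Union>\<phi>\<in>c. cohom_class X \<phi>) = c"
  using mem_cohom_class by (fastforce simp: cohom_class_eq dest: saturatedD(2))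

text \<open>This is how the generators of an edge-span algebra, which are pullbacks along span maps, come
  under the transport argument.\<close>

lemma pullback_saturated: "pullback X f c \<in> saturated X"
  unfolding pullback_def
  by (intro saturated_Union cohom_class_saturated cochain_pullback_supported)

lemma saturated_ops:
  "\<one>\<^bsub>cohomology X\<^esub> \<in> saturated X"
  "a \<in> saturated X \<Longrightarrow> b \<in> saturated X \<Longrightarrow> a \<otimes>\<^bsub>cohomology X\<^esub> b \<in> saturated X"
  "a \<in> saturated X \<Longrightarrow> b \<in> saturated X \<Longrightarrow> a \<oplus>\<^bsub>cohomology X\<^esub> b \<in> saturated X"
  "a \<in> saturated X \<Longrightarrow> q \<odot>\<^bsub>cohomology X\<^esub> a \<in> saturated X"
proof -
  show "a \<oplus>\<^bsub>cohomology X\<^esub> b \<in> saturated X" if a: "a \<in> saturated X" and b: "b \<in> saturated X"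
    unfolding saturated_def add_cohomology
  proof (intro CollectI conjI ballI)
    show "(\<Union>\<phi>\<in>a. \<Union>\<psi>\<in>b. {\<phi> + \<psi>}) \<subseteq> supported_cochains X"
      using saturatedD(1)[OF a] saturatedD(1)[OF b] by (auto intro: supported_cochains_ops)
    fix \<beta> \<omega> assume \<beta>: "\<beta> \<in> coboundaries X" and "\<omega> \<in> (\<Union>\<phi>\<in>a. \<Union>\<psi>\<in>b. {\<phi> + \<psi>})"
    then obtain \<phi> \<psi> where "\<phi> \<in> a" "\<psi> \<in> b" "\<beta> + \<omega> = (\<beta> + \<phi>) + \<psi>"
      by (auto simp: add.assoc)
    then show "\<beta> + \<omega> \<in> (\<Union>\<phi>\<in>a. \<Union>\<psi>\<in>b. {\<phi> + \<psi>})"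
      using saturatedD(2)[OF a \<beta>] by blast
  qed
qed (auto simp: cohomology_ops subset_iff
      intro!: saturated_Union cohom_class_saturated supported_cochains_ops dest: saturatedD(1))

lemma generated_subalgebra_saturated:
  assumes "S \<subseteq> saturated X"
  shows "generated_subalgebra (cohomology X) S \<subseteq> saturated X"
proof
  fix x assume "x \<in> generated_subalgebra (cohomology X) S"
  then show "x \<in> saturated X"
    by induction (use assms in \<open>auto intro: saturated_ops\<close>)
qed

lemma grade_saturated: "grade (cohomology X) p \<subseteq> saturated X"
  by (auto simp: grade_cohomology cochains_def supported_cochains_def intro!: cohom_class_saturated)


section \<open>Naturality of the cochain operations\<close>

lemma singular_simplex_front_face:
  assumes "singular_simplex m X s" "p \<le> m"
  shows "singular_simplex p X (front_face p s)"
proof -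
  have "continuous_map (subtopology (powertop_real UNIV) (standard_simplex p)) X s"
    using assms continuous_map_from_subtopology_mono standard_simplex_mono
    unfolding singular_simplex_def by blast
  then show ?thesis
    by (simp add: singular_simplex_def front_face_def)
qed

text \<open>The inclusion of the standard \<open>q\<close>-simplex as the last \<open>q\<close>-dimensional face, along which back
  faces are taken.\<close>

lemma shift_in_standard_simplex:
  assumes "t \<in> standard_simplex q"
  shows "(\<lambda>i. if i < p then 0 else t (i - p)) \<in> standard_simplex (p + q)"
proof -
  have "(\<Sum>i\<le>p + q. if i < p then 0 else t (i - p)) = (\<Sum>i\<in>{p..p + q}. t (i - p))"
    by (rule sum.mono_neutral_cong_right) auto
  also have "\<dots> = (\<Sum>i\<in>{0..q}. t i)"
    using sum.shift_bounds_cl_nat_ivl[of "\<lambda>i. t (i - p)" 0 p q] by (simp add: add.commute)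
  also have "\<dots> = 1"
    using assms by (simp add: standard_simplex_def atLeast0AtMost)
  finally show ?thesis
    using assms by (auto simp: standard_simplex_def)
qed

lemma singular_simplex_back_face:
  assumes "singular_simplex (p + q) X s"
  shows "singular_simplex q X (back_face p q s)"
proof -
  let ?j = "\<lambda>t i. if i < p then 0 else t (i - p) :: real"
  have "continuous_map (subtopology (powertop_real UNIV) (standard_simplex q))
      (subtopology (powertop_real UNIV) (standard_simplex (p + q))) ?j"
  proof (rule continuous_map_into_subtopology)
    have "continuous_map (powertop_real UNIV) euclideanreal (\<lambda>t. ?j t i)" for i
      by (auto intro: continuous_map_product_projection)
    then have "continuous_map (powertop_real UNIV) (powertop_real UNIV) ?j"
      by (simp add: continuous_map_componentwise_UNIV)
    then show "continuous_map (subtopology (powertop_real UNIV) (standard_simplex q))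
        (powertop_real UNIV) ?j"
      by (rule continuous_map_from_subtopology)
    show "?j \<in> topspace (subtopology (powertop_real UNIV) (standard_simplex q)) \<rightarrow>
        standard_simplex (p + q)"
      using shift_in_standard_simplex by auto
  qed
  then have "continuous_map (subtopology (powertop_real UNIV) (standard_simplex q)) X (s \<circ> ?j)"
    using assms continuous_map_compose unfolding singular_simplex_def by blast
  then show ?thesis
    by (simp add: singular_simplex_def back_face_def o_def)
qed

lemma front_face_simplex_map:
  "p \<le> m \<Longrightarrow> front_face p (simplex_map m f s) = simplex_map p f (front_face p s)"
  using standard_simplex_mono[of p m]
  by (auto simp: front_face_def simplex_map_def fun_eq_iff restrict_def)

lemma back_face_simplex_map:
  "back_face p q (simplex_map (p + q) f s) = simplex_map q f (back_face p q s)"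
  using shift_in_standard_simplex[of _ q p]
  by (auto simp: back_face_def simplex_map_def fun_eq_iff restrict_def)

lemma cochain_pullback_add:
  "cochain_pullback X f (\<phi> + \<psi>) = cochain_pullback X f \<phi> + cochain_pullback X f \<psi>"
  by (auto simp: cochain_pullback_def fun_eq_iff)

lemma cochain_pullback_smult:
  "cochain_pullback X f (\<lambda>p s. q * \<phi> p s) = (\<lambda>p s. q * cochain_pullback X f \<phi> p s)"
  by (auto simp: cochain_pullback_def fun_eq_iff)

lemma cochain_pullback_one:
  assumes "continuous_map X Y f"
  shows "cochain_pullback X f (\<lambda>p s. if p = 0 \<and> singular_simplex p Y s then 1 else 0) =
    (\<lambda>p s. if p = 0 \<and> singular_simplex p X s then 1 else 0)"
  using singular_simplex_simplex_map[OF _ assms]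
  by (auto simp: cochain_pullback_def fun_eq_iff)

lemma cochain_pullback_cup:
  assumes f: "continuous_map X Y f"
  shows "cochain_pullback X f (cup Y \<phi> \<psi>) = cup X (cochain_pullback X f \<phi>) (cochain_pullback X f \<psi>)"
proof (intro ext)
  fix m s
  show "cochain_pullback X f (cup Y \<phi> \<psi>) m s =
      cup X (cochain_pullback X f \<phi>) (cochain_pullback X f \<psi>) m s"
  proof (cases "singular_simplex m X s")
    case True
    then have Y: "singular_simplex m Y (simplex_map m f s)"
      using f by (rule singular_simplex_simplex_map)
    have "\<phi> p (front_face p (simplex_map m f s)) = cochain_pullback X f \<phi> p (front_face p s)"
      "\<psi> (m - p) (back_face p (m - p) (simplex_map m f s)) =
        cochain_pullback X f \<psi> (m - p) (back_face p (m - p) s)" if "p \<le> m" for p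
      using that singular_simplex_front_face[OF True] singular_simplex_back_face[of p "m - p" X s]
        back_face_simplex_map[of p "m - p" f s] True
      by (auto simp: cochain_pullback_def front_face_simplex_map)
    then have "cup Y \<phi> \<psi> m (simplex_map m f s) =
        cup X (cochain_pullback X f \<phi>) (cochain_pullback X f \<psi>) m s"
      using Y True by (simp add: cup_def)
    then show ?thesis
      using True by (simp add: cochain_pullback_def[of X f "cup Y \<phi> \<psi>"])
  qed (simp add: cup_def cochain_pullback_def)
qed

lemma cochain_pullback_coboundary:
  assumes f: "continuous_map X Y f"
  shows "cochain_pullback X f (coboundary Y \<phi>) = coboundary X (cochain_pullback X f \<phi>)"
proof (intro ext)
  fix p s
  show "cochain_pullback X f (coboundary Y \<phi>) p s = coboundary X (cochain_pullback X f \<phi>) p s"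
  proof (cases "0 < p \<and> singular_simplex p X s")
    case True
    then have Y: "singular_simplex p Y (simplex_map p f s)"
      using f singular_simplex_simplex_map by blast
    have "\<phi> (p - 1) (singular_face p k (simplex_map p f s)) =
        cochain_pullback X f \<phi> (p - 1) (singular_face p k s)" if "k \<le> p" for k
    proof -
      have "singular_face p k (simplex_map p f s) = simplex_map (p - 1) f (singular_face p k s)"
        using that True by (simp add: singular_face_simplex_map) (simp add: simplex_map_def singular_face_def
            fun_eq_iff restrict_def)
      then show ?thesis
        using that True singular_simplex_singular_face[of p X s k] by (simp add: cochain_pullback_def)
    qed
    then have "coboundary Y \<phi> p (simplex_map p f s) = coboundary X (cochain_pullback X f \<phi>) p s"
      using Y True by (simp add: coboundary_def)
    then show ?thesis
      using True by (simp add: cochain_pullback_def[of X f "coboundary Y \<phi>"])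
  qed (auto simp: coboundary_def cochain_pullback_def)
qed

lemma cochain_pullback_cochains:
  assumes "continuous_map X Y f" "\<phi> \<in> cochains Y"
  shows "cochain_pullback X f \<phi> \<in> cochains X"
proof -
  have "{p. cochain_pullback X f \<phi> p \<noteq> 0} \<subseteq> {p. \<phi> p \<noteq> 0}"
    by (auto simp: cochain_pullback_def fun_eq_iff)
  then have "finite {p. cochain_pullback X f \<phi> p \<noteq> 0}"
    using assms(2) by (auto simp: cochains_def intro: finite_subset)
  then show ?thesis
    by (auto simp: cochains_def cochain_pullback_def)
qed

lemma cochain_pullback_coboundaries:
  assumes "continuous_map X Y f" "\<beta> \<in> coboundaries Y"
  shows "cochain_pullback X f \<beta> \<in> coboundaries X"
  using assms by (auto simp: coboundaries_def cochain_pullback_coboundary cochain_pullback_cochains)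

lemma cochain_pullback_compose:
  assumes "continuous_map X Y f"
  shows "cochain_pullback X f (cochain_pullback Y g \<phi>) = cochain_pullback X (g \<circ> f) \<phi>"
  using singular_simplex_simplex_map[OF _ assms]
  by (auto simp: cochain_pullback_def fun_eq_iff simplex_map_compose)

lemma cochain_pullback_id:
  assumes "\<And>x. x \<in> topspace X \<Longrightarrow> f x = x" "\<phi> \<in> supported_cochains X"
  shows "cochain_pullback X f \<phi> = \<phi>"
proof (intro ext)
  fix p s
  show "cochain_pullback X f \<phi> p s = \<phi> p s"
    using simplex_map_id_gen[OF _ assms(1), of p X s] assms(2)
    by (simp add: cochain_pullback_def supported_cochains_def)
qed


section \<open>Homeomorphisms and generated subalgebras of cohomology\<close>

text \<open>Continuity of the first map \<open>f\<close> makes it carry coboundaries to coboundaries. The coboundaries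
  that the inner pullback adds are therefore absorbed by the outer one.\<close>

lemma pullback_compose:
  assumes f: "continuous_map X Y f"
  shows "pullback X f (pullback Y g c) = pullback X (g \<circ> f) c"
proof -
  let ?F = "cochain_pullback X f" and ?G = "cochain_pullback Y g"
  have "(\<Union>\<psi>\<in>cohom_class Y (?G \<phi>). cohom_class X (?F \<psi>)) = cohom_class X (cochain_pullback X (g \<circ> f) \<phi>)"
    for \<phi>
  proof
    show "(\<Union>\<psi>\<in>cohom_class Y (?G \<phi>). cohom_class X (?F \<psi>)) \<subseteq>
        cohom_class X (cochain_pullback X (g \<circ> f) \<phi>)"
      using cochain_pullback_coboundaries[OF f]
      by (auto simp: cohom_class_eq cochain_pullback_add cochain_pullback_compose[OF f]
          image_iff add.assoc[symmetric] intro: add_in_coboundaries)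
    show "cohom_class X (cochain_pullback X (g \<circ> f) \<phi>) \<subseteq>
        (\<Union>\<psi>\<in>cohom_class Y (?G \<phi>). cohom_class X (?F \<psi>))"
      using mem_cohom_class[of "?G \<phi>" Y] by (auto simp: cochain_pullback_compose[OF f, symmetric])
  qed
  then show ?thesis
    by (simp add: pullback_def)
qed

context
  fixes X :: "'a topology" and Y :: "'b topology" and f g
  assumes homeo: "homeomorphic_maps X Y f g"
begin

lemma homeo_continuous: "continuous_map X Y f" "continuous_map Y X g"
  using homeo by (auto simp: homeomorphic_maps_def)

lemma cochain_pullback_inverse:
  assumes "\<phi> \<in> supported_cochains X"
  shows "cochain_pullback X f (cochain_pullback Y g \<phi>) = \<phi>"
  using homeo assms by (auto simp: cochain_pullback_compose[OF homeo_continuous(1)] homeomorphic_maps_def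
        intro!: cochain_pullback_id)

lemma bij_betw_cochain_pullback:
  "bij_betw (cochain_pullback X f) (supported_cochains Y) (supported_cochains X)"
proof (rule bij_betw_byWitness[where f' = "cochain_pullback Y g"])
  show "\<forall>\<phi>\<in>supported_cochains Y. cochain_pullback Y g (cochain_pullback X f \<phi>) = \<phi>"
    using homeo by (auto simp: cochain_pullback_compose[OF homeo_continuous(2)] homeomorphic_maps_def
        intro!: cochain_pullback_id)
  show "\<forall>\<phi>\<in>supported_cochains X. cochain_pullback X f (cochain_pullback Y g \<phi>) = \<phi>"
    by (simp add: cochain_pullback_inverse)
qed (auto intro: cochain_pullback_supported)

lemma image_coboundaries: "cochain_pullback X f ` coboundaries Y = coboundaries X"
proof
  show "cochain_pullback X f ` coboundaries Y \<subseteq> coboundaries X"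
    using cochain_pullback_coboundaries homeo_continuous(1) by blast
  show "coboundaries X \<subseteq> cochain_pullback X f ` coboundaries Y"
  proof
    fix \<beta> assume \<beta>: "\<beta> \<in> coboundaries X"
    then have "\<beta> = cochain_pullback X f (cochain_pullback Y g \<beta>)"
      using coboundaries_supported cochain_pullback_inverse by fastforce
    then show "\<beta> \<in> cochain_pullback X f ` coboundaries Y"
      using cochain_pullback_coboundaries[OF homeo_continuous(2) \<beta>] by (rule image_eqI)
  qed
qed

text \<open>Cosets go to cosets because the bijection is additive and matches the two groups of
  coboundaries.\<close>

lemma image_cohom_class:
  "cochain_pullback X f ` cohom_class Y \<phi> = cohom_class X (cochain_pullback X f \<phi>)"
  by (auto simp: cohom_class_eq image_image cochain_pullback_add image_coboundaries[symmetric])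

text \<open>The union over representatives in the definition of the pullback collapses: the cosets that it
  adds are the images of cosets already contained in \<open>c\<close>.\<close>

lemma pullback_eq_image:
  assumes "c \<in> saturated Y"
  shows "pullback X f c = cochain_pullback X f ` c"
proof -
  have "pullback X f c = cochain_pullback X f ` (\<Union>\<phi>\<in>c. cohom_class Y \<phi>)"
    by (simp add: pullback_def image_UN image_cohom_class)
  then show ?thesis
    using assms by (simp add: saturated_eq_Union_cohom_class)
qed

lemma inj_on_pullback: "inj_on (pullback X f) (saturated Y)"
proof (rule inj_onI)
  fix a b assume ab: "a \<in> saturated Y" "b \<in> saturated Y" "pullback X f a = pullback X f b"
  then have "cochain_pullback X f ` a = cochain_pullback X f ` b"
    by (simp add: pullback_eq_image)
  moreover have "inj_on (cochain_pullback X f) (supported_cochains Y)"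
    using bij_betw_cochain_pullback by (simp add: bij_betw_def)
  ultimately show "a = b"
    using ab saturatedD(1) inj_on_image_eq_iff by metis
qed

lemma pullback_ops:
  "pullback X f \<one>\<^bsub>cohomology Y\<^esub> = \<one>\<^bsub>cohomology X\<^esub>"
  "a \<in> saturated Y \<Longrightarrow> b \<in> saturated Y \<Longrightarrow>
    pullback X f (a \<otimes>\<^bsub>cohomology Y\<^esub> b) = pullback X f a \<otimes>\<^bsub>cohomology X\<^esub> pullback X f b"
  "a \<in> saturated Y \<Longrightarrow> b \<in> saturated Y \<Longrightarrow>
    pullback X f (a \<oplus>\<^bsub>cohomology Y\<^esub> b) = pullback X f a \<oplus>\<^bsub>cohomology X\<^esub> pullback X f b"
  "a \<in> saturated Y \<Longrightarrow> pullback X f (q \<odot>\<^bsub>cohomology Y\<^esub> a) = q \<odot>\<^bsub>cohomology X\<^esub> pullback X f a"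
  \<comment> \<open>Both sides become unions of images of cosets, which agree by naturality on cochains.\<close>
  by (simp_all only: pullback_eq_image saturated_ops)
    (simp_all add: cohomology_ops image_UN image_cohom_class cochain_pullback_add
      cochain_pullback_smult cochain_pullback_one[OF homeo_continuous(1)]
      cochain_pullback_cup[OF homeo_continuous(1)])

lemma pullback_grade: "pullback X f ` grade (cohomology Y) p = grade (cohomology X) p"
proof -
  let ?Z = "\<lambda>X. {\<phi> \<in> cochains X. coboundary X \<phi> = 0 \<and> (\<forall>q. q \<noteq> p \<longrightarrow> \<phi> q = 0)}"
  \<comment> \<open>Stated for arbitrary spaces since it is needed for \<open>f\<close> and for the inverse \<open>g\<close>.\<close>
  have sub: "cochain_pullback U h ` ?Z V \<subseteq> ?Z U" if h: "continuous_map U V h"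
    for U :: "'c topology" and V :: "'d topology" and h
  proof clarify
    fix \<phi> assume \<phi>: "\<phi> \<in> cochains V" "coboundary V \<phi> = 0" "\<forall>q. q \<noteq> p \<longrightarrow> \<phi> q = 0"
    have "coboundary U (cochain_pullback U h \<phi>) = cochain_pullback U h 0"
      using cochain_pullback_coboundary[OF h, of \<phi>] \<phi> by simp
    also have "\<dots> = 0"
      by (auto simp: cochain_pullback_def fun_eq_iff)
    finally show "cochain_pullback U h \<phi> \<in> cochains U \<and> coboundary U (cochain_pullback U h \<phi>) = 0 \<and>
        (\<forall>q. q \<noteq> p \<longrightarrow> cochain_pullback U h \<phi> q = 0)"
      using \<phi> cochain_pullback_cochains[OF h] by (auto simp: cochain_pullback_def fun_eq_iff)
  qed
  have "?Z X \<subseteq> cochain_pullback X f ` ?Z Y"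
  proof
    fix \<phi> assume \<phi>: "\<phi> \<in> ?Z X"
    then have "\<phi> \<in> supported_cochains X"
      by (auto simp: cochains_def supported_cochains_def)
    then have "\<phi> = cochain_pullback X f (cochain_pullback Y g \<phi>)"
      by (simp add: cochain_pullback_inverse)
    moreover have "cochain_pullback Y g \<phi> \<in> ?Z Y"
      using sub[OF homeo_continuous(2)] \<phi> by blast
    ultimately show "\<phi> \<in> cochain_pullback X f ` ?Z Y"
      by (rule image_eqI)
  qed
  then have Z: "cochain_pullback X f ` ?Z Y = ?Z X"
    using sub[OF homeo_continuous(1)] by blast
  have "pullback X f ` grade (cohomology Y) p = (\<lambda>c. cochain_pullback X f ` c) ` grade (cohomology Y) p"
    using grade_saturated by (intro image_cong refl pullback_eq_image) blast
  also have "\<dots> = cohom_class X ` (cochain_pullback X f ` ?Z Y)"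
    by (simp add: grade_cohomology image_image image_cohom_class)
  also have "\<dots> = grade (cohomology X) p"
    unfolding Z grade_cohomology ..
  finally show ?thesis .
qed

lemma pullback_generated_subalgebra:
  assumes S: "S \<subseteq> saturated Y"
  shows "pullback X f ` generated_subalgebra (cohomology Y) S =
    generated_subalgebra (cohomology X) (pullback X f ` S)"
proof
  note sat = generated_subalgebra_saturated[OF S, THEN subsetD]
  show "pullback X f ` generated_subalgebra (cohomology Y) S \<subseteq>
      generated_subalgebra (cohomology X) (pullback X f ` S)"
  proof clarify
    fix x assume "x \<in> generated_subalgebra (cohomology Y) S"
    then show "pullback X f x \<in> generated_subalgebra (cohomology X) (pullback X f ` S)"
      by induction (auto simp: pullback_ops sat intro: generated_subalgebra.intros)
  qed
  show "generated_subalgebra (cohomology X) (pullback X f ` S) \<subseteq>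
      pullback X f ` generated_subalgebra (cohomology Y) S"
  proof
    fix y assume "y \<in> generated_subalgebra (cohomology X) (pullback X f ` S)"
    then show "y \<in> pullback X f ` generated_subalgebra (cohomology Y) S"
    proof induction
      case one
      then show ?case
        by (metis pullback_ops(1) generated_subalgebra.one imageI)
    next
      case (incl x)
      then show ?case
        by (auto intro: generated_subalgebra.incl)
    next
      case (add x y)
      then show ?case
        by (auto simp: pullback_ops(3)[symmetric] sat intro!: imageI generated_subalgebra.add)
    next
      case (mult x y)
      then show ?case
        by (auto simp: pullback_ops(2)[symmetric] sat intro!: imageI generated_subalgebra.mult)
    next
      case (smult x q)
      then show ?case
        by (auto simp: pullback_ops(4)[symmetric] sat intro!: imageI generated_subalgebra.smult)
    qed
  qed
qed

text \<open>Injectivity on saturated sets is what lets the image commute with the intersection that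
  defines the grading of the subalgebra.\<close>

theorem homeomorphism_pullback_subalgebra_iso:
  assumes S: "S \<subseteq> saturated Y"
  shows "pullback X f \<in> graded_alg_iso (subalgebra_generated_by (cohomology Y) S)
    (subalgebra_generated_by (cohomology X) (pullback X f ` S))"
proof -
  let ?A = "generated_subalgebra (cohomology Y) S"
  let ?B = "generated_subalgebra (cohomology X) (pullback X f ` S)"
  note sat = generated_subalgebra_saturated[OF S]
  have img: "pullback X f ` ?A = ?B"
    using S by (rule pullback_generated_subalgebra)
  have "pullback X f ` (?A \<inter> grade (cohomology Y) p) = ?B \<inter> grade (cohomology X) p" for p
    using inj_on_image_Int[OF inj_on_pullback sat grade_saturated, of p] by (simp add: img pullback_grade)
  moreover have "bij_betw (pullback X f) ?A ?B"
    using img inj_on_subset[OF inj_on_pullback sat] by (simp add: bij_betw_def)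
  ultimately show ?thesis
    using img sat
    by (auto simp: graded_alg_iso_def ring_iso_def ring_hom_def subalgebra_generated_by_def
        pullback_ops subset_iff)
qed

end


section \<open>Relabelling configuration spaces\<close>

lemma relabel_relabel: "relabel \<tau> (relabel \<sigma> G) = relabel (\<tau> \<circ> \<sigma>) G"
  by (simp add: relabel_def image_comp image_image)

lemma relabel_id: "relabel id (G :: 'v graph) = G"
  by (simp add: relabel_def)

lemma simple_graph_relabel:
  assumes "simple_graph G" "inj \<sigma>"
  shows "simple_graph (relabel \<sigma> G)"
  unfolding simple_graph_def
proof (intro conjI ballI)
  show "finite (vertices (relabel \<sigma> G))"
    using assms by (simp add: simple_graph_def relabel_def)
  fix e assume "e \<in> edges (relabel \<sigma> G)"
  then obtain u v where "u \<in> vertices G" "v \<in> vertices G" "u \<noteq> v" "e = {\<sigma> u, \<sigma> v}"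
    using assms(1) by (fastforce simp: simple_graph_def relabel_def)
  then show "\<exists>u\<in>vertices (relabel \<sigma> G). \<exists>v\<in>vertices (relabel \<sigma> G). u \<noteq> v \<and> e = {u, v}"
    using assms(2) by (fastforce simp: relabel_def dest: injD)
qed

lemma edge_subset_vertices: "simple_graph G \<Longrightarrow> e \<in> edges G \<Longrightarrow> e \<subseteq> vertices G"
  by (auto simp: simple_graph_def)

lemma relabel_conf_relabel_conf:
  "relabel_conf \<sigma> G (relabel_conf \<tau> (relabel \<sigma> G) l) = relabel_conf (\<tau> \<circ> \<sigma>) G l"
  by (auto simp: relabel_conf_def relabel_def fun_eq_iff)

lemma relabel_conf_id: "l \<in> topspace (conf T G) \<Longrightarrow> relabel_conf id G l = l"
  by (auto simp: relabel_conf_def conf_def fun_eq_iff PiE_def extensional_def)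

text \<open>Both ends of an edge have to be vertices, since at any other index the relabelled configuration
  is \<open>undefined\<close> and the condition on that edge would be lost.\<close>

lemma continuous_map_relabel_conf:
  fixes T :: "'n::finite itself"
  assumes "simple_graph G"
  shows "continuous_map (conf T (relabel \<sigma> G)) (conf T G) (relabel_conf \<sigma> G)"
proof -
  let ?P = "\<lambda>V. product_topology (\<lambda>_. projective_space :: (complex^'n) set topology) V"
  have "continuous_map (?P (vertices (relabel \<sigma> G))) (?P (vertices G)) (relabel_conf \<sigma> G)"
    by (auto simp: continuous_map_componentwise relabel_conf_def relabel_def
        intro: continuous_map_product_projection)
  moreover have "relabel_conf \<sigma> G l u \<noteq> relabel_conf \<sigma> G l v"
    if l: "\<forall>u v. {u, v} \<in> edges (relabel \<sigma> G) \<longrightarrow> l u \<noteq> l v" and uv: "{u, v} \<in> edges G"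
    for l :: "'a \<Rightarrow> (complex^'n) set" and u v
  proof -
    have "{\<sigma> u, \<sigma> v} \<in> edges (relabel \<sigma> G)"
      using imageI[OF uv, of "(`) \<sigma>"] by (simp add: relabel_def)
    moreover have "u \<in> vertices G" "v \<in> vertices G"
      using edge_subset_vertices[OF assms uv] by auto
    ultimately show ?thesis
      using l[rule_format, of "\<sigma> u" "\<sigma> v"] by (simp add: relabel_conf_def)
  qed
  ultimately show ?thesis
    unfolding conf_def
    by (intro continuous_map_into_subtopology continuous_map_from_subtopology) auto
qed

lemma homeomorphic_maps_relabel_conf:
  assumes G: "simple_graph G" and \<sigma>: "bij \<sigma>"
  shows "homeomorphic_maps (conf T (relabel \<sigma> G)) (conf T G)
    (relabel_conf \<sigma> G) (relabel_conf (inv_into UNIV \<sigma>) (relabel \<sigma> G))"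
proof -
  have inv: "inv_into UNIV \<sigma> \<circ> \<sigma> = id" "\<sigma> \<circ> inv_into UNIV \<sigma> = id"
    using \<sigma> by (auto simp: bij_is_inj surj_iff[symmetric] bij_is_surj)
  have undo: "relabel (inv_into UNIV \<sigma>) (relabel \<sigma> G) = G"
    by (simp add: relabel_relabel inv relabel_id)
  have "continuous_map (conf T G) (conf T (relabel \<sigma> G)) (relabel_conf (inv_into UNIV \<sigma>) (relabel \<sigma> G))"
    using continuous_map_relabel_conf[OF simple_graph_relabel[OF G bij_is_inj[OF \<sigma>]], of T "inv_into UNIV \<sigma>"]
    by (simp add: undo)
  moreover have "relabel_conf (inv_into UNIV \<sigma>) (relabel \<sigma> G) (relabel_conf \<sigma> G l) =
      relabel_conf id (relabel \<sigma> G) l" for l :: "'a \<Rightarrow> (complex^'b) set"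
    using relabel_conf_relabel_conf[of "inv_into UNIV \<sigma>" "relabel \<sigma> G" \<sigma> l] by (simp add: undo inv)
  ultimately show ?thesis
    using continuous_map_relabel_conf[OF G]
    by (simp add: homeomorphic_maps_def relabel_conf_relabel_conf inv relabel_conf_id)
qed

lemma span_map_relabel_conf:
  "e \<subseteq> vertices G \<Longrightarrow> span_map e (relabel_conf \<sigma> G l) = span_map (\<sigma> ` e) l"
  unfolding span_map_def by (rule arg_cong[where f = vec.span]) (auto simp: relabel_conf_def)

text \<open>Functoriality, applied to the composite of the span map with the permutation of coordinates.\<close>

lemma relabel_map_pullback_span_map:
  assumes "simple_graph G" "e \<in> edges G"
  shows "relabel_map T \<sigma> G (pullback (conf T G) (span_map e) c) =
    pullback (conf T (relabel \<sigma> G)) (span_map (\<sigma> ` e)) c"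
proof -
  have span: "span_map e \<circ> relabel_conf \<sigma> G = span_map (\<sigma> ` e)"
    using span_map_relabel_conf[OF edge_subset_vertices[OF assms]] by (auto simp: fun_eq_iff)
  show ?thesis
    by (simp add: relabel_map_def pullback_compose[OF continuous_map_relabel_conf[OF assms(1)]] span)
qed

lemma relabel_map_edge_classes:
  assumes "simple_graph G" "e \<in> edges G"
  shows "relabel_map T \<sigma> G (edge_a T G e) = edge_a T (relabel \<sigma> G) (\<sigma> ` e)"
    and "relabel_map T \<sigma> G (edge_b T G e) = edge_b T (relabel \<sigma> G) (\<sigma> ` e)"
  using relabel_map_pullback_span_map[OF assms] by (simp_all add: edge_a_def edge_b_def)

lemma relabel_map_compose:
  assumes "simple_graph G" "inj \<sigma>"
  shows "relabel_map T (\<tau> \<circ> \<sigma>) G x = relabel_map T \<tau> (relabel \<sigma> G) (relabel_map T \<sigma> G x)"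
proof -
  have comp: "relabel_conf \<sigma> G \<circ> relabel_conf \<tau> (relabel \<sigma> G) =
      (relabel_conf (\<tau> \<circ> \<sigma>) G :: ('a \<Rightarrow> (complex^'b) set) \<Rightarrow> 'a \<Rightarrow> (complex^'b) set)"
    by (rule ext) (simp only: o_apply relabel_conf_relabel_conf)
  have "relabel_map T \<tau> (relabel \<sigma> G) (relabel_map T \<sigma> G x) =
      pullback (conf T (relabel \<tau> (relabel \<sigma> G))) (relabel_conf \<sigma> G \<circ> relabel_conf \<tau> (relabel \<sigma> G)) x"
    unfolding relabel_map_def
    by (rule pullback_compose[OF continuous_map_relabel_conf[OF simple_graph_relabel[OF assms]]])
  then show ?thesis
    by (simp only: comp relabel_relabel relabel_map_def)
qed

lemma relabel_map_graded_alg_iso: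
  assumes G: "simple_graph G" and \<sigma>: "bij \<sigma>"
  shows "relabel_map T \<sigma> G \<in>
    graded_alg_iso (edge_span_algebra T G) (edge_span_algebra T (relabel \<sigma> G))"
proof -
  let ?gens = "\<lambda>G. edge_a T G ` edges G \<union> edge_b T G ` edges G"
  have gens: "relabel_map T \<sigma> G ` ?gens G = ?gens (relabel \<sigma> G)"
  proof -
    have edges: "edges (relabel \<sigma> G) = (`) \<sigma> ` edges G"
      by (simp add: relabel_def)
    show ?thesis
      unfolding edges image_Un image_image
      using relabel_map_edge_classes[OF G] by (intro arg_cong2[where f = "(\<union>)"] image_cong refl)
  qed
  have "?gens G \<subseteq> saturated (conf T G)"
    by (auto simp: edge_a_def edge_b_def pullback_saturated)
  then have "pullback (conf T (relabel \<sigma> G)) (relabel_conf \<sigma> G) \<in> graded_alg_iso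
      (subalgebra_generated_by (cohomology (conf T G)) (?gens G))
      (subalgebra_generated_by (cohomology (conf T (relabel \<sigma> G)))
        (pullback (conf T (relabel \<sigma> G)) (relabel_conf \<sigma> G) ` ?gens G))"
    by (rule homeomorphism_pullback_subalgebra_iso[OF homeomorphic_maps_relabel_conf[OF assms]])
  then show ?thesis
    by (simp only: edge_span_algebra_def relabel_map_def gens[unfolded relabel_map_def])
qed


section \<open>Isomorphism classes\<close>

lemma graded_alg_iso_compose:
  assumes f: "f \<in> graded_alg_iso A B" and g: "g \<in> graded_alg_iso B C"
  shows "g \<circ> f \<in> graded_alg_iso A C"
proof -
  have "g \<circ> f \<in> ring_iso A C"
    using f g by (auto simp: graded_alg_iso_def intro: ring_iso_set_trans)
  moreover have "f x \<in> carrier B" if "x \<in> carrier A" for x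
    using f that by (auto simp: graded_alg_iso_def ring_iso_def ring_hom_def)
  moreover have "(g \<circ> f) ` grade A p = grade C p" for p
    using f g unfolding image_comp[symmetric] by (simp add: graded_alg_iso_def)
  ultimately show ?thesis
    using f g by (simp add: graded_alg_iso_def)
qed

text \<open>For bare algebra records, which carry no closure axioms, the inverse of an isomorphism need not
  be one, so an isomorphism in each direction is required.\<close>

lemma iso_class_eqI:
  assumes "f \<in> graded_alg_iso A B" "g \<in> graded_alg_iso B A"
  shows "iso_class A = iso_class B"
  using assms graded_alg_iso_compose unfolding iso_class_def by blast

lemma iso_class_edge_span_algebra_relabel:
  assumes G: "simple_graph G" and \<sigma>: "bij \<sigma>"
  shows "iso_class (edge_span_algebra T G) = iso_class (edge_span_algebra T (relabel \<sigma> G))"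
proof (rule iso_class_eqI)
  show "relabel_map T \<sigma> G \<in> graded_alg_iso (edge_span_algebra T G) (edge_span_algebra T (relabel \<sigma> G))"
    using assms by (rule relabel_map_graded_alg_iso)
  have "inv_into UNIV \<sigma> \<circ> \<sigma> = id"
    using \<sigma> by (simp add: bij_is_inj)
  then have "relabel (inv_into UNIV \<sigma>) (relabel \<sigma> G) = G"
    by (simp add: relabel_relabel relabel_id)
  then show "relabel_map T (inv_into UNIV \<sigma>) (relabel \<sigma> G) \<in>
      graded_alg_iso (edge_span_algebra T (relabel \<sigma> G)) (edge_span_algebra T G)"
    using relabel_map_graded_alg_iso[OF simple_graph_relabel[OF G bij_is_inj[OF \<sigma>]] bij_imp_bij_inv[OF \<sigma>], of T]
    by simp
qed

lemma graph_isomorphic_imp_relabel: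
  fixes G H :: "'v graph"
  assumes G: "simple_graph G" and H: "simple_graph H" and V: "vertices G = vertices H"
    and iso: "graph_isomorphic G H"
  obtains \<sigma> where "\<sigma> permutes vertices G" "H = relabel \<sigma> G"
proof -
  obtain f where f: "bij_betw f (vertices G) (vertices H)"
    and adj: "\<And>u v. u \<in> vertices G \<Longrightarrow> v \<in> vertices G \<Longrightarrow> {u, v} \<in> edges G \<longleftrightarrow> {f u, f v} \<in> edges H"
    using iso by (auto simp: graph_isomorphic_def)
  \<comment> \<open>Extended by the identity, as a permutation of the vertex set has to fix everything else.\<close>
  define \<sigma> where "\<sigma> x = (if x \<in> vertices G then f x else x)" for x
  have "bij_betw \<sigma> (vertices G) (vertices G)"
    unfolding \<sigma>_def using f V by (subst bij_betw_cong[where g = f]) auto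
  then have \<sigma>: "\<sigma> permutes vertices G"
    by (rule bij_imp_permutes) (simp add: \<sigma>_def)
  have "edges H = (`) \<sigma> ` edges G"
  proof
    show "(`) \<sigma> ` edges G \<subseteq> edges H"
    proof clarify
      fix e assume e: "e \<in> edges G"
      then obtain u v where "u \<in> vertices G" "v \<in> vertices G" "e = {u, v}"
        using G by (auto simp: simple_graph_def)
      then show "\<sigma> ` e \<in> edges H"
        using e adj by (simp add: \<sigma>_def)
    qed
    show "edges H \<subseteq> (`) \<sigma> ` edges G"
    proof
      fix e assume e: "e \<in> edges H"
      then obtain u' v' where "u' \<in> vertices H" "v' \<in> vertices H" "e = {u', v'}"
        using H by (auto simp: simple_graph_def)
      then obtain u v where uv: "u \<in> vertices G" "v \<in> vertices G" "e = {f u, f v}"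
        unfolding bij_betw_imp_surj_on[OF f, symmetric] by blast
      then have "{u, v} \<in> edges G" "e = \<sigma> ` {u, v}"
        using e adj by (simp_all add: \<sigma>_def)
      then show "e \<in> (`) \<sigma> ` edges G"
        by blast
    qed
  qed
  then have "H = relabel \<sigma> G"
    using V permutes_image[OF \<sigma>] by (simp add: relabel_def)
  with \<sigma> show ?thesis
    by (rule that)
qed


section \<open>Invariance of the edge-span algebra\<close>

theorem corollary5p1:
  fixes G :: "nat graph" and r :: nat
  assumes n: "CARD('n::finite) \<ge> 2"
    and G: "simple_graph G" "vertices G = {1..r}"
  shows "(\<forall>\<sigma>. \<sigma> permutes {1..r} \<longrightarrow>
        relabel_map TYPE('n) \<sigma> G \<in> graded_alg_iso
          (edge_span_algebra TYPE('n) G) (edge_span_algebra TYPE('n) (relabel \<sigma> G)) \<and>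
        (\<forall>i j. {i, j} \<in> edges G \<longrightarrow>
          relabel_map TYPE('n) \<sigma> G (edge_a TYPE('n) G {i, j}) =
            edge_a TYPE('n) (relabel \<sigma> G) {\<sigma> i, \<sigma> j} \<and>
          relabel_map TYPE('n) \<sigma> G (edge_b TYPE('n) G {i, j}) =
            edge_b TYPE('n) (relabel \<sigma> G) {\<sigma> i, \<sigma> j})) \<and>
    (\<forall>\<sigma> \<tau>. \<sigma> permutes {1..r} \<and> \<tau> permutes {1..r} \<longrightarrow>
        (\<forall>x \<in> carrier (edge_span_algebra TYPE('n) G).
          relabel_map TYPE('n) (\<tau> \<circ> \<sigma>) G x =
            relabel_map TYPE('n) \<tau> (relabel \<sigma> G) (relabel_map TYPE('n) \<sigma> G x))) \<and>
    (\<forall>(H :: nat graph) s. simple_graph H \<and> vertices H = {1..s} \<and> graph_isomorphic G H \<longrightarrow>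
        iso_class (edge_span_algebra TYPE('n) G) = iso_class (edge_span_algebra TYPE('n) H))"
proof (intro conjI allI impI ballI)
  fix \<sigma> assume "\<sigma> permutes {1..r}"
  then show "relabel_map TYPE('n) \<sigma> G \<in> graded_alg_iso
      (edge_span_algebra TYPE('n) G) (edge_span_algebra TYPE('n) (relabel \<sigma> G))"
    using G(1) by (intro relabel_map_graded_alg_iso permutes_bij)
next
  fix \<sigma> :: "nat \<Rightarrow> nat" and i j assume "{i, j} \<in> edges G"
  then show "relabel_map TYPE('n) \<sigma> G (edge_a TYPE('n) G {i, j}) =
        edge_a TYPE('n) (relabel \<sigma> G) {\<sigma> i, \<sigma> j}"
    and "relabel_map TYPE('n) \<sigma> G (edge_b TYPE('n) G {i, j}) =
        edge_b TYPE('n) (relabel \<sigma> G) {\<sigma> i, \<sigma> j}"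
    using relabel_map_edge_classes[OF G(1), of "{i, j}"] by simp_all
next
  fix \<sigma> \<tau> x assume "\<sigma> permutes {1..r} \<and> \<tau> permutes {1..r}"
  then show "relabel_map TYPE('n) (\<tau> \<circ> \<sigma>) G x =
      relabel_map TYPE('n) \<tau> (relabel \<sigma> G) (relabel_map TYPE('n) \<sigma> G x)"
    using relabel_map_compose[OF G(1)] permutes_inj by blast
next
  fix H :: "nat graph" and s
  assume H: "simple_graph H \<and> vertices H = {1..s} \<and> graph_isomorphic G H"
  then obtain f where "bij_betw f (vertices G) (vertices H)"
    by (auto simp: graph_isomorphic_def)
  \<comment> \<open>Equal numbers of vertices give \<open>r = s\<close>, hence one common vertex set.\<close>
  then have "card (vertices G) = card (vertices H)"
    by (rule bij_betw_same_card)
  then have "vertices G = vertices H"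
    using G(2) H by simp
  then obtain \<sigma> where "\<sigma> permutes {1..r}" "H = relabel \<sigma> G"
    using graph_isomorphic_imp_relabel[of G H] G H by metis
  then show "iso_class (edge_span_algebra TYPE('n) G) = iso_class (edge_span_algebra TYPE('n) H)"
    using iso_class_edge_span_algebra_relabel[OF G(1)] permutes_bij by metis
qed

end
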